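(* Let $n\ge2$. Every nilpotent element $X\in\mathfrak{so}(n,\mathbb{C})$ is strongly real, i.e. there exists $\tau\in\mathrm{SO}(n,\mathbb{C})$ with $\tau^2=\mathrm{Id}$ and $\tau X\tau^{-1}=-X$.
   Context: For a Lie group $G$ with Lie algebra $\mathfrak{g}$, $X\in\mathfrak{g}$ is strongly real (strongly $\mathrm{Ad}_G$-real) if $-X=\mathrm{Ad}(\tau)X$ for some $\tau\in G$ with $\tau^2=\mathrm{Id}$. $\mathrm{SO}(n,\mathbb{C})=\{g\in\mathrm{SL}_n(\mathbb{C})\mid g^tg=\mathrm{I}_n\}$ and $\mathfrak{so}(n,\mathbb{C})=\{z\in\mathfrak{sl}_n(\mathbb{C})\mid z^t+z=0\}$. *)

theory Defs
  imports
    Complex_Main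
    "Jordan_Normal_Form.Determinant"
    "Jordan_Normal_Form.Gauss_Jordan_Elimination"
begin

definition mat_trace :: "complex mat \<Rightarrow> complex" where
  "mat_trace A = (\<Sum>i<dim_row A. A $$ (i, i))"

definition SL :: "nat \<Rightarrow> complex mat set" where
  "SL n = {g \<in> carrier_mat n n. det g = 1}"

definition sl :: "nat \<Rightarrow> complex mat set" where
  "sl n = {z \<in> carrier_mat n n. mat_trace z = 0}"

(* Orthogonality is with respect to the symmetric bilinear form given by the
   plain transpose; no complex conjugation is involved. *)

definition SO :: "nat \<Rightarrow> complex mat set" where
  "SO n = {g \<in> SL n. transpose_mat g * g = 1\<^sub>m n}"

definition so :: "nat \<Rightarrow> complex mat set" where
  "so n = {z \<in> sl n. transpose_mat z + z = 0\<^sub>m n n}"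

definition nilpotent_mat :: "complex mat \<Rightarrow> bool" where
  "nilpotent_mat X \<longleftrightarrow> (\<exists>k. X ^\<^sub>m k = 0\<^sub>m (dim_row X) (dim_col X))"

(* Meaningful only for invertible g, where mat_inverse g is Some inverse;
   see Ad_eq. *)

definition Ad :: "complex mat \<Rightarrow> complex mat \<Rightarrow> complex mat" where
  "Ad g X = g * X * the (mat_inverse g)"

definition strongly_Ad_real :: "complex mat set \<Rightarrow> complex mat \<Rightarrow> bool" where
  "strongly_Ad_real G X \<longleftrightarrow>
     (\<exists>\<tau>\<in>G. \<tau> * \<tau> = 1\<^sub>m (dim_row \<tau>) \<and> - X = Ad \<tau> X)"

lemma Ad_eq:
  assumes g: "g \<in> carrier_mat n n" and h: "h \<in> carrier_mat n n"
    and gh: "g * h = 1\<^sub>m n"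
  shows "Ad g X = g * X * h"
proof -
  have hg: "h * g = 1\<^sub>m n"
    using mat_mult_left_right_inverse[OF g h gh] .
  have "g \<in> Units (ring_mat TYPE(complex) n ())"
    using g h gh hg unfolding Units_def ring_mat_def by auto
  then obtain B where B: "mat_inverse g = Some B"
    using mat_inverse(1)[OF g, of "()"] by (cases "mat_inverse g") auto
  note B' = mat_inverse(2)[OF g B]
  have "B = h * g * B"
    using hg B' left_mult_one_mat[of B n n] by metis
  also have "\<dots> = h * (g * B)"
    using g h B' by (intro assoc_mult_mat) auto
  also have "\<dots> = h"
    using h B' right_mult_one_mat[of h n n] by metis
  finally show ?thesis
    by (simp add: Ad_def B)
qed

end

theory Submission
  imports Defs
begin

text \<open>Decompose \<open>\<complex>\<^sup>n\<close> orthogonally into \<open>X\<close>-invariant nondegenerate blocks, peeling them off greedily. On the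
  orthogonal complement of the blocks found so far let \<open>X\<^sup>k\<close> be the highest nonzero power of \<open>X\<close>. The
  form \<open>(u, v) \<mapsto> X\<^sup>k u \<bullet> v\<close> is symmetric for even \<open>k\<close> and alternating for odd \<open>k\<close>. If \<open>k\<close> is even, some
  \<open>v\<close> satisfies \<open>X\<^sup>k v \<bullet> v \<noteq> 0\<close> and its chain \<open>v, X v, \<dots>, X\<^sup>k v\<close> spans a block, on which
  \<open>X\<^sup>j v \<mapsto> \<plusminus> (-1)\<^sup>j X\<^sup>j v\<close> is an orthogonal involution; the dimension is odd, so the sign can be chosen to
  give determinant 1. If \<open>k\<close> is odd, two chains, normalized so that \<open>X\<^sup>j u \<bullet> w = 0\<close> for \<open>j < k\<close>, span a
  block, and \<open>X\<^sup>j u \<mapsto> (-1)\<^sup>j X\<^sup>j u\<close>, \<open>X\<^sup>j w \<mapsto> - (-1)\<^sup>j X\<^sup>j w\<close> is an orthogonal involution of determinant 1.\<close>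

section \<open>Linear algebra over a field: kernels and anti-triangular matrices\<close>

text \<open>Padding with zero rows gives a square matrix \<open>B\<close> of determinant zero, and a
  kernel vector of \<open>B\<close> serves for \<open>A\<close>.\<close>

lemma wide_mat_kernel:
  fixes A :: "'a :: field mat"
  assumes A: "A \<in> carrier_mat m n" and "m < n"
  obtains v where "v \<in> carrier_vec n" "v \<noteq> 0\<^sub>v n" "A *\<^sub>v v = 0\<^sub>v m"
proof -
  define B where "B = mat n n (\<lambda>(i, j). if i < m then A $$ (i, j) else 0)"
  have B: "B \<in> carrier_mat n n"
    by (simp add: B_def)
  have "B = mat\<^sub>r n n (\<lambda>i. if i = m then 0\<^sub>v n else row B i)"
    by (rule eq_matI) (auto simp: B_def)
  moreover have "det (mat\<^sub>r n n (\<lambda>i. if i = m then 0\<^sub>v n else row B i)) = 0"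
    using \<open>m < n\<close> B by (intro det_row_0) auto
  ultimately have "det B = 0"
    by simp
  then obtain v where v: "v \<in> carrier_vec n" "v \<noteq> 0\<^sub>v n" "B *\<^sub>v v = 0\<^sub>v n"
    using det_0_iff_vec_prod_zero_field[OF B] by blast
  have "(A *\<^sub>v v) $ i = 0" if "i < m" for i
  proof -
    have "row A i = row B i"
      using that \<open>m < n\<close> A by (intro eq_vecI) (auto simp: B_def)
    then have "(A *\<^sub>v v) $ i = (B *\<^sub>v v) $ i"
      using that \<open>m < n\<close> A B by simp
    then show ?thesis
      using v that \<open>m < n\<close> by simp
  qed
  then have "A *\<^sub>v v = 0\<^sub>v m"
    using A by (intro eq_vecI) auto
  with v that show ?thesis
    by blast
qed

text \<open>Forward substitution: in row \<open>d - 1 - j\<close> the entries beyond column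
  \<open>j\<close> vanish, so a kernel vector has its coordinates forced to zero one after the
  other, starting at 0.\<close>

lemma anti_triangular_det_nonzero:
  fixes G :: "'a :: field mat"
  assumes G: "G \<in> carrier_mat d d"
    and zero: "\<And>i j. i < d \<Longrightarrow> j < d \<Longrightarrow> d \<le> i + j \<Longrightarrow> G $$ (i, j) = 0"
    and anti: "\<And>i j. i + j + 1 = d \<Longrightarrow> G $$ (i, j) \<noteq> 0"
  shows "det G \<noteq> 0"
proof
  assume "det G = 0"
  then obtain v where v: "v \<in> carrier_vec d" "v \<noteq> 0\<^sub>v d" "G *\<^sub>v v = 0\<^sub>v d"
    using det_0_iff_vec_prod_zero_field[OF G] by blast
  have "v $ j = 0" if "j < d" for j
    using that
  proof (induction j rule: less_induct)
    case (less j)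
    define i where "i = d - 1 - j"
    have i: "i < d" "i + j + 1 = d"
      using less.prems by (auto simp: i_def)
    have "0 = (G *\<^sub>v v) $ i"
      using v(3) i(1) by simp
    also have "\<dots> = (\<Sum>k = 0..<d. G $$ (i, k) * v $ k)"
      using G v(1) i(1) by (auto simp: scalar_prod_def intro!: sum.cong)
    also have "\<dots> = (\<Sum>k = 0..<d. if k = j then G $$ (i, k) * v $ k else 0)"
    proof (intro sum.cong refl)
      fix k assume k: "k \<in> {0..<d}"
      consider "k < j" | "k = j" | "k > j" by linarith
      then show "G $$ (i, k) * v $ k = (if k = j then G $$ (i, k) * v $ k else 0)"
        using k less.IH zero[of i k] i by cases auto
    qed
    also have "\<dots> = G $$ (i, j) * v $ j"
      using less.prems by simp
    finally show ?case
      using anti[OF i(2)] by simp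
  qed
  then have "v = 0\<^sub>v d"
    using v(1) by (intro eq_vecI) auto
  with v(2) show False ..
qed

section \<open>Frames: gluing them and reading off the involution\<close>

text \<open>The columns of \<open>Q\<close> are a basis of an \<open>X\<close>-invariant nondegenerate subspace, on which \<open>X\<close> and
  the sought involution act by the matrices \<open>N\<close> and \<open>D\<close>.\<close>

definition frame :: "complex mat \<Rightarrow> nat \<Rightarrow> nat \<Rightarrow> complex mat \<Rightarrow> complex mat \<Rightarrow> complex mat \<Rightarrow> bool" where
  "frame X n m Q N D \<longleftrightarrow>
     Q \<in> carrier_mat n m \<and> N \<in> carrier_mat m m \<and> D \<in> carrier_mat m m \<and>
     X * Q = Q * N \<and> D * N = - (N * D) \<and> D * D = 1\<^sub>m m \<and> det D = 1 \<and>
     transpose_mat D * (transpose_mat Q * Q) * D = transpose_mat Q * Q \<and>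
     det (transpose_mat Q * Q) \<noteq> 0"

text \<open>With more columns than rows, a kernel vector of \<open>Q\<close> would also be killed by
  the Gram matrix.\<close>

lemma frame_size:
  assumes "frame X n m Q N D"
  shows "m \<le> n"
proof (rule ccontr)
  assume "\<not> m \<le> n"
  have Q: "Q \<in> carrier_mat n m" and nz: "det (transpose_mat Q * Q) \<noteq> 0"
    using assms by (auto simp: frame_def)
  obtain v where v: "v \<in> carrier_vec m" "v \<noteq> 0\<^sub>v m" "Q *\<^sub>v v = 0\<^sub>v n"
    using wide_mat_kernel[OF Q] \<open>\<not> m \<le> n\<close> by auto
  have QQ: "transpose_mat Q * Q \<in> carrier_mat m m"
    using Q by simp
  have "(transpose_mat Q * Q) *\<^sub>v v = transpose_mat Q *\<^sub>v (Q *\<^sub>v v)"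
    using Q v(1) by (intro assoc_mult_mat_vec) auto
  also have "\<dots> = 0\<^sub>v m"
    using Q v(3) by auto
  finally show False
    using v nz det_0_iff_vec_prod_zero_field[OF QQ] by blast
qed

text \<open>Orthogonality makes the joint Gram matrix block diagonal, so every condition on a frame
  can be checked block by block.\<close>

lemma frame_append:
  assumes X: "X \<in> carrier_mat n n"
    and F: "frame X n m Q N D" and G: "frame X n k W M E"
    and orth: "transpose_mat Q * W = 0\<^sub>m m k"
  shows "\<exists>Q' N' D'. frame X n (m + k) Q' N' D'"
proof -
  note F = F[unfolded frame_def] and G = G[unfolded frame_def]
  have Q: "Q \<in> carrier_mat n m" and N: "N \<in> carrier_mat m m" and D: "D \<in> carrier_mat m m"
    and W: "W \<in> carrier_mat n k" and M: "M \<in> carrier_mat k k" and E: "E \<in> carrier_mat k k"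
    using F G by auto
  have QQ: "transpose_mat Q * Q \<in> carrier_mat m m" and WW: "transpose_mat W * W \<in> carrier_mat k k"
    using Q W by simp_all
  have orth': "transpose_mat W * Q = 0\<^sub>m k m"
    using transpose_mult[of "transpose_mat Q" m n W k] Q W orth by simp
  \<comment> \<open>\<open>Q\<close> and \<open>W\<close> side by side; the lower blocks have height
    0 and only serve to make the block multiplication rule applicable. \<open>X\<close> is padded in
    the same way below.\<close>
  define Z where "Z = four_block_mat Q W (0\<^sub>m 0 m) (0\<^sub>m 0 k)"
  define B :: "complex mat \<Rightarrow> complex mat \<Rightarrow> complex mat"
    where "B S T = four_block_mat S (0\<^sub>m m k) (0\<^sub>m k m) T" for S T
  have Bmult: "B S T * B S' T' = B (S * S') (T * T')"
    if "S \<in> carrier_mat m m" "S' \<in> carrier_mat m m" "T \<in> carrier_mat k k" "T' \<in> carrier_mat k k"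
    for S S' T T'
    unfolding B_def using that
    by (subst mult_four_block_mat[of _ m m _ k _ k _ _ m _ k]) (auto intro!: cong_four_block_mat)
  have Z: "Z \<in> carrier_mat n (m + k)"
    using Q W by (auto simp: Z_def four_block_carrier_mat)
  have B: "B S T \<in> carrier_mat (m + k) (m + k)"
    if "S \<in> carrier_mat m m" "T \<in> carrier_mat k k" for S T
    using that by (auto simp: B_def)
  have Zt: "transpose_mat Z = four_block_mat (transpose_mat Q) (0\<^sub>m m 0) (transpose_mat W) (0\<^sub>m k 0)"
    unfolding Z_def using Q W by (subst transpose_four_block_mat[of _ n m _ k _ 0]) auto
  have Bt: "transpose_mat (B D E) = B (transpose_mat D) (transpose_mat E)"
    unfolding B_def using D E by (subst transpose_four_block_mat[of _ m m _ k _ k]) auto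
  have gram: "transpose_mat Z * Z = B (transpose_mat Q * Q) (transpose_mat W * W)"
    unfolding Zt unfolding Z_def B_def using Q W orth orth'
    by (subst mult_four_block_mat[of _ m n _ 0 _ k _ _ m _ k]) (auto intro!: cong_four_block_mat)
  have "X * Z = four_block_mat (X * Q) (X * W) (0\<^sub>m 0 m) (0\<^sub>m 0 k)"
  proof -
    have "X = four_block_mat X (0\<^sub>m n 0) (0\<^sub>m 0 n) (0\<^sub>m 0 0)"
      using X by (intro eq_matI) auto
    then have "X * Z = four_block_mat X (0\<^sub>m n 0) (0\<^sub>m 0 n) (0\<^sub>m 0 0) * Z"
      by simp
    also have "\<dots> = four_block_mat (X * Q) (X * W) (0\<^sub>m 0 m) (0\<^sub>m 0 k)"
      unfolding Z_def using X Q W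
      by (subst mult_four_block_mat[of _ n n _ 0 _ 0 _ _ m _ k]) (auto intro!: cong_four_block_mat)
    finally show ?thesis .
  qed
  also have "\<dots> = Z * B N M"
    unfolding Z_def B_def using Q W N M F G
    by (subst mult_four_block_mat[of _ n m _ k _ 0 _ _ m _ k]) (auto intro!: cong_four_block_mat)
  finally have XZ: "X * Z = Z * B N M" .
  have "B D E * B N M = - (B N M * B D E)"
    using D E N M F G by (simp add: Bmult) (auto simp: B_def intro!: eq_matI)
  moreover have "B D E * B D E = 1\<^sub>m (m + k)"
    using D E F G by (simp add: Bmult) (simp add: B_def)
  moreover have det: "det (B S T) = det S * det T"
    if "S \<in> carrier_mat m m" "T \<in> carrier_mat k k" for S T
    unfolding B_def using that by (intro det_four_block_mat_lower_left_zero) auto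
  have "det (B D E) = 1"
    using det[OF D E] F G by simp
  moreover have "det (transpose_mat Z * Z) \<noteq> 0"
    using det[OF QQ WW] F G by (simp add: gram)
  moreover have "transpose_mat (B D E) * (transpose_mat Z * Z) * B D E = transpose_mat Z * Z"
    using D E F G by (simp add: gram Bt Bmult[OF _ QQ _ WW] Bmult[OF mult_carrier_mat[OF _ QQ] _ mult_carrier_mat[OF _ WW]])
  ultimately have "frame X n (m + k) Z (B N M) (B D E)"
    using Z B[OF N M] B[OF D E] XZ by (simp add: frame_def)
  then show ?thesis
    by blast
qed

text \<open>A square \<open>Q\<close> is a change of basis. Conjugating \<open>D\<close> by it gives
  the involution \<open>T\<close>, and invariance of the Gram matrix under \<open>D\<close> becomes
  orthogonality of \<open>T\<close>.\<close>

lemma frame_total_strongly_real: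
  assumes X: "X \<in> carrier_mat n n" and F: "frame X n n Q N D"
  shows "strongly_Ad_real (SO n) X"
proof -
  note F = F[unfolded frame_def]
  have Q: "Q \<in> carrier_mat n n" and N: "N \<in> carrier_mat n n" and D: "D \<in> carrier_mat n n"
    using F by auto
  have "det Q \<noteq> 0"
    using F det_mult[of "transpose_mat Q" n Q] Q by auto
  then obtain P where P: "P \<in> carrier_mat n n" "P * Q = 1\<^sub>m n" "Q * P = 1\<^sub>m n"
    using det_non_zero_imp_unit[OF Q, of "()"] by (auto simp: Units_def ring_mat_def)
  note c = Q N D X P(1)
  define T where "T = Q * D * P"
  have T: "T \<in> carrier_mat n n"
    using c by (simp add: T_def)
  have cancel: "P * (Q * A) = A" "Q * (P * A) = A" if "A \<in> carrier_mat n n" for A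
    using c P that by (simp_all add: assoc_mult_mat[symmetric, of _ n n _ n _ n])
  note assoc = assoc_mult_mat[of _ n n _ n _ n]
  have DD: "D * (D * A) = A" if "A \<in> carrier_mat n n" for A
    using c that F by (simp add: assoc_mult_mat[symmetric, of _ n n _ n _ n])
  have TT: "T * T = 1\<^sub>m n"
    using c P by (simp add: T_def assoc cancel DD)
  have "det T = det D * (det Q * det P)"
    using c by (simp add: T_def det_mult[of _ n])
  also have "det Q * det P = 1"
    using det_mult[OF Q P(1)] P(3) by simp
  finally have detT: "det T = 1"
    using F by simp
  have PQt: "transpose_mat P * transpose_mat Q = 1\<^sub>m n"
    using transpose_mult[OF Q P(1)] P by simp
  then have "transpose_mat P * (transpose_mat Q * A) = A" if "A \<in> carrier_mat n n" for A
    using c that by (simp add: assoc_mult_mat[symmetric, of _ n n _ n _ n])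
  moreover have "transpose_mat T = transpose_mat P * (transpose_mat D * transpose_mat Q)"
    using c by (simp add: T_def transpose_mult[of _ n n _ n])
  moreover have "transpose_mat D * (transpose_mat Q * (Q * (D * P))) = transpose_mat Q * (Q * P)"
  proof -
    have "transpose_mat D * (transpose_mat Q * (Q * (D * P)))
        = transpose_mat D * (transpose_mat Q * Q) * D * P"
      using c by (simp add: assoc)
    also have "\<dots> = transpose_mat Q * (Q * P)"
      using c F by (simp add: assoc)
    finally show ?thesis .
  qed
  ultimately have orth: "transpose_mat T * T = 1\<^sub>m n"
    using c P PQt by (simp add: T_def assoc)
  have "X = X * Q * P"
    using c P by (simp add: assoc)
  also have "\<dots> = Q * N * P"
    using F by simp
  finally have XQNP: "X = Q * N * P" .
  have DND: "D * N * D = - N"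
  proof -
    have "D * N * D = - (N * D) * D"
      using F by simp
    also have "\<dots> = - (N * (D * D))"
      using c by (simp add: assoc)
    finally show ?thesis
      using F c by simp
  qed
  \<comment> \<open>\<open>T\<close> is its own inverse, so this product is
    \<open>Ad T X\<close>.\<close>
  have "T * X * T = Q * (D * N * D) * P"
    unfolding XQNP T_def using c by (simp add: assoc cancel)
  also have "\<dots> = - X"
    unfolding DND XQNP using c by simp
  finally have "- X = Ad T X"
    by (simp add: Ad_eq[OF T T TT])
  then show ?thesis
    unfolding strongly_Ad_real_def SO_def SL_def
    using T TT detT orth by auto
qed

text \<open>Here \<open>X\<close> shifts the list \<open>c\<close> by \<open>r\<close> places, so
  \<open>r\<close> chains can be interleaved, and the involution is diagonal with signs
  \<open>s\<close>. \<open>s_shift\<close> gives anticommutation with \<open>X\<close>,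
  \<open>s_orth\<close> invariance of the form, and \<open>zero\<close> with \<open>anti\<close> an
  anti-triangular Gram matrix.\<close>

lemma frame_of_chains:
  fixes c :: "nat \<Rightarrow> complex vec" and s :: "nat \<Rightarrow> complex"
  assumes X: "X \<in> carrier_mat n n"
    and c: "\<And>j. c j \<in> carrier_vec n"
    and shift: "\<And>j. X *\<^sub>v c j = c (j + r)"
    and stop: "\<And>j. d \<le> j \<Longrightarrow> c j = 0\<^sub>v n"
    and zero: "\<And>i j. d \<le> i + j \<Longrightarrow> c i \<bullet> c j = 0"
    and anti: "\<And>i j. i + j + 1 = d \<Longrightarrow> c i \<bullet> c j \<noteq> 0"
    and s_sq: "\<And>j. s j * s j = 1"
    and s_shift: "\<And>j. s (j + r) = - s j"
    and s_orth: "\<And>i j. s i \<noteq> s j \<Longrightarrow> c i \<bullet> c j = 0"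
    and s_prod: "(\<Prod>j = 0..<d. s j) = 1"
  shows "\<exists>N D. frame X n d (mat_of_cols n (map c [0..<d])) N D"
proof -
  define Q where "Q = mat_of_cols n (map c [0..<d])"
  define N :: "complex mat" where "N = mat d d (\<lambda>(i, j). if i = j + r then 1 else 0)"
  define D where "D = mat d d (\<lambda>(i, j). if i = j then s i else 0)"
  have Q: "Q \<in> carrier_mat n d" and N: "N \<in> carrier_mat d d" and D: "D \<in> carrier_mat d d"
    using mat_of_cols_carrier(1)[of n "map c [0..<d]"] by (simp_all add: Q_def N_def D_def)
  have col: "col Q j = c j" if "j < d" for j
    using that c by (simp add: Q_def)
  have gram: "(transpose_mat Q * Q) $$ (i, j) = c i \<bullet> c j" if "i < d" "j < d" for i j
    using that Q by (simp add: col)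
  have DA: "(D * A) $$ (i, j) = s i * A $$ (i, j)"
    if "A \<in> carrier_mat d d" "i < d" "j < d" for A i j
  proof -
    have "(D * A) $$ (i, j) = (\<Sum>k = 0..<d. D $$ (i, k) * A $$ (k, j))"
      using that D by (auto simp: scalar_prod_def intro!: sum.cong)
    also have "\<dots> = (\<Sum>k = 0..<d. if k = i then s i * A $$ (i, j) else 0)"
      using that by (intro sum.cong) (auto simp: D_def)
    finally show ?thesis
      using that by simp
  qed
  have AD: "(A * D) $$ (i, j) = A $$ (i, j) * s j"
    if "A \<in> carrier_mat d d" "i < d" "j < d" for A i j
  proof -
    have "(A * D) $$ (i, j) = (\<Sum>k = 0..<d. A $$ (i, k) * D $$ (k, j))"
      using that D by (auto simp: scalar_prod_def intro!: sum.cong)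
    also have "\<dots> = (\<Sum>k = 0..<d. if k = j then A $$ (i, j) * s j else 0)"
      using that by (intro sum.cong) (auto simp: D_def)
    finally show ?thesis
      using that by simp
  qed
  have Dt: "transpose_mat D = D"
    by (rule eq_matI) (auto simp: D_def)
  have "X * Q = Q * N"
  proof (rule eq_matI)
    fix i j assume "i < dim_row (Q * N)" "j < dim_col (Q * N)"
    then have ij: "i < n" "j < d"
      using Q N by auto
    have "(X * Q) $$ (i, j) = (X *\<^sub>v c j) $ i"
      using ij X Q by (simp add: col)
    also have "\<dots> = c (j + r) $ i"
      by (simp add: shift)
    \<comment> \<open>If \<open>j + r\<close> runs past the block, the sum is empty of nonzero terms
      and \<open>c (j + r)\<close> is zero by \<open>stop\<close>.\<close>
    also have "\<dots> = (\<Sum>k = 0..<d. if k = j + r then c k $ i else 0)"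
      using stop[of "j + r"] ij by simp
    also have "\<dots> = (\<Sum>k = 0..<d. Q $$ (i, k) * N $$ (k, j))"
      using ij by (intro sum.cong) (auto simp: N_def Q_def mat_of_cols_index)
    also have "\<dots> = (Q * N) $$ (i, j)"
      using ij Q N by (auto simp: scalar_prod_def intro!: sum.cong)
    finally show "(X * Q) $$ (i, j) = (Q * N) $$ (i, j)" .
  qed (use X Q N in auto)
  moreover have "D * N = - (N * D)"
  proof (rule eq_matI)
    fix i j assume "i < dim_row (- (N * D))" "j < dim_col (- (N * D))"
    then have ij: "i < d" "j < d"
      using N D by auto
    then have "(- (N * D)) $$ (i, j) = - (N $$ (i, j) * s j)"
      using N D AD[OF N] by simp
    then show "(D * N) $$ (i, j) = (- (N * D)) $$ (i, j)"
      using ij DA[OF N] s_shift by (simp add: N_def)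
  qed (use N D in auto)
  moreover have "D * D = 1\<^sub>m d"
    by (rule eq_matI) (use DA[OF D] D s_sq in \<open>auto simp: D_def\<close>)
  moreover have "det D = (\<Prod>j = 0..<d. s j)"
  proof -
    have "det D = prod_list (diag_mat D)"
      using D by (intro det_upper_triangular) (auto simp: D_def)
    also have "diag_mat D = map s [0..<d]"
      using D by (auto simp: diag_mat_def D_def)
    finally show ?thesis
      using prod.distinct_set_conv_list[of "[0..<d]" s] by simp
  qed
  moreover have "transpose_mat D * (transpose_mat Q * Q) * D = transpose_mat Q * Q"
  proof (rule eq_matI)
    fix i j assume "i < dim_row (transpose_mat Q * Q)" "j < dim_col (transpose_mat Q * Q)"
    then have ij: "i < d" "j < d"
      using Q by auto
    have QQ: "transpose_mat Q * Q \<in> carrier_mat d d"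
      using Q by simp
    have "(D * (transpose_mat Q * Q) * D) $$ (i, j) = s i * (c i \<bullet> c j) * s j"
      using ij D QQ by (simp add: AD DA gram del: index_mult_mat)
    also have "\<dots> = c i \<bullet> c j"
      using s_orth[of i j] s_sq[of j] by (cases "s i = s j") (auto simp: mult.commute mult.left_commute)
    finally show "(transpose_mat D * (transpose_mat Q * Q) * D) $$ (i, j) = (transpose_mat Q * Q) $$ (i, j)"
      using ij by (simp add: Dt gram del: index_mult_mat)
  qed (use Q D in auto)
  moreover have "det (transpose_mat Q * Q) \<noteq> 0"
    using Q by (intro anti_triangular_det_nonzero[of _ d])
      (auto simp: gram zero anti simp del: index_mult_mat(1))
  ultimately have "frame X n d Q N D"
    using Q N D s_prod by (simp add: frame_def)
  then show ?thesis
    unfolding Q_def by blast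
qed

section \<open>Powers of a nilpotent skew matrix and the bilinear form\<close>

locale nilpotent_skew =
  fixes n :: nat and X :: "complex mat"
  assumes X: "X \<in> carrier_mat n n"
    and skew: "transpose_mat X = - X"
    and nilpotent: "nilpotent_mat X"
begin

abbreviation iter :: "nat \<Rightarrow> complex vec \<Rightarrow> complex vec" where
  "iter k \<equiv> ((*\<^sub>v) X) ^^ k"

lemma iter_carrier [simp]: "v \<in> carrier_vec n \<Longrightarrow> iter k v \<in> carrier_vec n"
  using X by (induction k) auto

lemma iter_eq_pow: "v \<in> carrier_vec n \<Longrightarrow> iter k v = (X ^\<^sub>m k) *\<^sub>v v"
proof (induction k arbitrary: v)
  case (Suc k)
  have "iter (Suc k) v = (X ^\<^sub>m k) *\<^sub>v (X *\<^sub>v v)"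
    using Suc X by (simp add: funpow_Suc_right del: funpow.simps)
  also have "\<dots> = (X ^\<^sub>m k * X) *\<^sub>v v"
    using Suc.prems X by (intro assoc_mult_mat_vec[symmetric]) (auto intro: pow_carrier_mat)
  finally show ?case
    by simp
qed (use X in simp)

lemma iter_add: "u \<in> carrier_vec n \<Longrightarrow> v \<in> carrier_vec n \<Longrightarrow> iter k (u + v) = iter k u + iter k v"
  using X by (simp add: iter_eq_pow mult_add_distrib_mat_vec[of _ n n] pow_carrier_mat)

lemma iter_zero: "iter k (0\<^sub>v n) = 0\<^sub>v n"
  using X by (induction k) auto

lemma iter_iter: "iter i (iter j v) = iter (i + j) v"
  by (simp add: funpow_add)

lemma iter_zero_mono:
  assumes "iter k v = 0\<^sub>v n" "k \<le> j"
  shows "iter j v = 0\<^sub>v n"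
  using iter_iter[of "j - k" k v] assms by (simp add: iter_zero)

lemma iter_nilpotent: "\<exists>k. \<forall>v\<in>carrier_vec n. iter k v = 0\<^sub>v n"
proof -
  obtain k where "X ^\<^sub>m k = 0\<^sub>m n n"
    using nilpotent X by (auto simp: nilpotent_mat_def)
  then have "iter k v = 0\<^sub>v n" if "v \<in> carrier_vec n" for v
    using that by (auto simp: iter_eq_pow)
  then show ?thesis
    by blast
qed

lemma skew_scalar_prod:
  assumes "u \<in> carrier_vec n" "v \<in> carrier_vec n"
  shows "u \<bullet> (X *\<^sub>v v) = - ((X *\<^sub>v u) \<bullet> v)"
  using transpose_vec_mult_scalar[OF X assms(2,1)] assms X by (simp add: skew uminus_mult_mat_vec)

text \<open>Each factor \<open>X\<close> moved across the product costs one sign.\<close>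

lemma iter_scalar_prod:
  assumes "u \<in> carrier_vec n" "v \<in> carrier_vec n"
  shows "iter i u \<bullet> iter j v = (-1) ^ j * (iter (i + j) u \<bullet> v)"
  using assms
proof (induction j arbitrary: i)
  case (Suc j)
  then show ?case
    using skew_scalar_prod[of "iter i u" "iter j v"] Suc.IH[of "Suc i"] by simp
qed simp

lemma iter_scalar_prod_swap:
  assumes "u \<in> carrier_vec n" "v \<in> carrier_vec n"
  shows "iter k v \<bullet> u = (-1) ^ k * (iter k u \<bullet> v)"
  using iter_scalar_prod[OF assms, of 0 k] assms comm_scalar_prod[of u n "iter k v"] by simp

text \<open>Swapping the two equal arguments changes the sign of the value.\<close>

lemma iter_scalar_prod_odd:
  assumes "v \<in> carrier_vec n" "odd k"
  shows "iter k v \<bullet> v = 0"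
  using iter_scalar_prod_swap[OF assms(1,1), of k] assms(2) by simp

section \<open>Blocks spanned by one or two chains\<close>

text \<open>Up to sign, Gram entries depend only on \<open>i + j\<close>: they vanish above
  \<open>k\<close> by nilpotency, are nonzero at \<open>k\<close>, and vanish for odd
  \<open>i + j\<close>, which is exactly when the signs differ.\<close>

lemma frame_one_chain:
  assumes v: "v \<in> carrier_vec n" and "even k"
    and top: "iter (Suc k) v = 0\<^sub>v n" and nz: "iter k v \<bullet> v \<noteq> 0"
  shows "\<exists>N D. frame X n (Suc k) (mat_of_cols n (map (\<lambda>j. iter j v) [0..<Suc k])) N D"
proof -
  obtain l where k: "k = 2 * l"
    using \<open>even k\<close> by blast
  have dead: "iter j v = 0\<^sub>v n" if "Suc k \<le> j" for j
    using iter_zero_mono[OF top that] .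
  \<comment> \<open>The global sign makes the determinant of the involution 1 on this odd-dimensional block.\<close>
  define s :: "nat \<Rightarrow> complex" where "s j = (-1) ^ (l + j)" for j
  have gram: "iter i v \<bullet> iter j v = (-1) ^ j * (iter (i + j) v \<bullet> v)" for i j
    by (rule iter_scalar_prod[OF v v])
  have "(\<Prod>j = 0..<Suc (2 * l). s j) = 1"
  proof -
    have "(\<Prod>j = 0..<Suc (2 * l). s j) = (-1) ^ (\<Sum>j = 0..<Suc (2 * l). l + j)"
      by (simp only: s_def power_sum)
    \<comment> \<open>The constant part and the Gauss sum both equal \<open>l * Suc (2 * l)\<close>,
      so the exponent is even.\<close>
    also have "(\<Sum>j = 0..<Suc (2 * l). l + j) = 2 * (l * Suc (2 * l))"
      using gauss_sum_nat[of "2 * l"] by (simp add: sum.distrib atLeast0LessThan lessThan_Suc_atMost atLeast0AtMost)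
    finally show ?thesis
      by simp
  qed
  then have prod: "(\<Prod>j = 0..<Suc k. s j) = 1"
    by (simp only: k)
  show ?thesis
  proof (rule frame_of_chains[where r = 1 and s = s, OF X])
    show "iter i v \<bullet> iter j v = 0" if "Suc k \<le> i + j" for i j
      using dead[OF that] v by (simp add: gram)
    show "iter i v \<bullet> iter j v \<noteq> 0" if "i + j + 1 = Suc k" for i j
      using nz that by (simp add: gram)
    show "iter i v \<bullet> iter j v = 0" if "s i \<noteq> s j" for i j
    proof -
      have "odd (i + j)"
        using that by (cases "even i"; cases "even j") (auto simp: s_def power_add)
      then show ?thesis
        by (simp add: gram iter_scalar_prod_odd[OF v])
    qed
  qed (use v dead prod in \<open>auto simp: s_def simp flip: power_add\<close>)
qed

text \<open>For odd \<open>k\<close> the top product within one chain is zero, so nondegeneracy must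
  come from pairing \<open>u\<close> with \<open>w\<close>; \<open>below\<close> removes the mixed
  products under the top level.\<close>

lemma frame_two_chains:
  assumes u: "u \<in> carrier_vec n" and w: "w \<in> carrier_vec n" and "odd k"
    and top: "iter (Suc k) u = 0\<^sub>v n" "iter (Suc k) w = 0\<^sub>v n"
    and nz: "iter k u \<bullet> w \<noteq> 0"
    and below: "\<And>i. i < k \<Longrightarrow> iter i u \<bullet> w = 0"
  shows "\<exists>N D. frame X n (2 * Suc k)
    (mat_of_cols n (map (\<lambda>j. iter (j div 2) (if even j then u else w)) [0..<2 * Suc k])) N D"
proof -
  \<comment> \<open>Interleaving the two chains makes the Gram matrix anti-triangular: two vectors of the same chain
    at total level \<open>k\<close> are orthogonal because \<open>k\<close> is odd.\<close>
  define b where "b j = (if even j then u else w)" for j :: nat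
  define c where "c j = iter (j div 2) (b j)" for j
  \<comment> \<open>The summand \<open>j div 2\<close> alternates the sign along each chain; the
    summand \<open>j\<close> gives the two chains opposite starting signs.\<close>
  define s :: "nat \<Rightarrow> complex" where "s j = (-1) ^ (j div 2 + j)" for j
  have b: "b j \<in> carrier_vec n" for j
    using u w by (simp add: b_def)
  have dead: "iter j (b i) = 0\<^sub>v n" if "Suc k \<le> j" for i j
    using iter_zero_mono[OF top(1) that] iter_zero_mono[OF top(2) that] by (simp add: b_def)
  have gram: "c i \<bullet> c j = (-1) ^ (j div 2) * (iter (i div 2 + j div 2) (b i) \<bullet> b j)" for i j
    unfolding c_def by (rule iter_scalar_prod[OF b b])
  have wu: "iter l w \<bullet> u = (-1) ^ l * (iter l u \<bullet> w)" for l
    by (rule iter_scalar_prod_swap[OF u w])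
  have mixed: "iter l (b i) \<bullet> b j = 0" if "l \<noteq> k" "even i \<noteq> even j" for l i j
  proof (cases "l < k")
    case True
    then show ?thesis
      using that below by (auto simp: b_def wu)
  next
    case False
    then show ?thesis
      using that dead[of l i] b[of j] by simp
  qed
  have same: "iter l (b i) \<bullet> b j = 0" if "odd l" "even i = even j" for l i j
    using that iter_scalar_prod_odd[OF u] iter_scalar_prod_odd[OF w] by (auto simp: b_def)
  have "\<exists>N D. frame X n (2 * Suc k) (mat_of_cols n (map c [0..<2 * Suc k])) N D"
  proof (rule frame_of_chains[where r = 2 and s = s, OF X])
    show "c i \<bullet> c j = 0" if "2 * Suc k \<le> i + j" for i j
    proof (cases "Suc k \<le> i div 2 + j div 2")
      case True
      then show ?thesis
        using dead[OF True] b by (simp add: gram)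
    next
      case False
      \<comment> \<open>Rounding loses enough only if both indices are odd. Both vectors then lie in
        the chain of \<open>w\<close>, at odd total level \<open>k\<close>.\<close>
      then have "i div 2 + j div 2 = k \<and> odd i \<and> odd j"
        using that by presburger
      then show ?thesis
        using same[of k i j] \<open>odd k\<close> by (simp add: gram)
    qed
    show "c i \<bullet> c j \<noteq> 0" if "i + j + 1 = 2 * Suc k" for i j
    proof -
      have "i div 2 + j div 2 = k" "even i \<noteq> even j"
        using that by presburger+
      then show ?thesis
        using nz by (auto simp: gram b_def wu)
    qed
    show "c i \<bullet> c j = 0" if "s i \<noteq> s j" for i j
    proof -
      \<comment> \<open>Different signs mean either one chain at odd total level, or two chains at
        even total level, which cannot be \<open>k\<close>.\<close>
      have par: "odd (i div 2 + j div 2 + i + j)"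
        using that by (cases "even (i div 2 + i)"; cases "even (j div 2 + j)") (auto simp: s_def)
      show ?thesis
      proof (cases "even i = even j")
        case True
        then have "odd (i div 2 + j div 2)"
          using par by auto
        then show ?thesis
          using same[OF _ True] by (simp add: gram)
      next
        case False
        then have "i div 2 + j div 2 \<noteq> k"
          using par \<open>odd k\<close> by auto
        then show ?thesis
          using mixed[OF _ False] by (simp add: gram)
      qed
    qed
    \<comment> \<open>Each level contributes a pair of opposite signs, and the number
      \<open>k + 1\<close> of levels is even.\<close>
    have s_prod: "(\<Prod>j = 0..<2 * l. s j) = (-1) ^ l" for l
      by (induction l) (auto simp: s_def power_add)
    show "(\<Prod>j = 0..<2 * Suc k. s j) = 1"
      unfolding s_prod using \<open>odd k\<close> by simp
    show "X *\<^sub>v c j = c (j + 2)" for j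
      by (simp add: c_def b_def)
    show "c j \<in> carrier_vec n" for j
      using b by (simp add: c_def)
    show "c j = 0\<^sub>v n" if "2 * Suc k \<le> j" for j
      using that dead by (simp add: c_def)
    show "s j * s j = 1" for j
      by (simp add: s_def flip: power_mult_distrib)
    show "s (j + 2) = - s j" for j
      by (simp add: s_def)
  qed
  then show ?thesis
    by (simp only: c_def[abs_def] b_def)
qed

text \<open>Adding \<open>a \<cdot> X\<^sup>l w\<close> to \<open>w\<close> changes the product with \<open>X\<^sup>k\<^sup>-\<^sup>l u\<close> by a nonzero multiple of \<open>a\<close>
  and none of the products with higher powers.\<close>

lemma normalize_chain_partner:
  assumes u: "u \<in> carrier_vec n" and top: "iter (Suc k) u = 0\<^sub>v n"
    and S: "\<And>a x y. x \<in> S \<Longrightarrow> y \<in> S \<Longrightarrow> x + a \<cdot>\<^sub>v y \<in> S" "\<And>x. x \<in> S \<Longrightarrow> X *\<^sub>v x \<in> S"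
      "S \<subseteq> carrier_vec n"
    and v: "v \<in> S" and nz: "iter k u \<bullet> v \<noteq> 0"
  shows "\<exists>w\<in>S. iter k u \<bullet> w \<noteq> 0 \<and> (\<forall>i<k. k \<le> i + l \<longrightarrow> iter i u \<bullet> w = 0)"
\<comment> \<open>Stage \<open>l\<close> has cleared the products at levels \<open>k - l\<close> to
  \<open>k - 1\<close>; at \<open>l = k\<close> none is left.\<close>
proof (induction l)
  case 0
  show ?case
    using v nz by auto
next
  case (Suc l)
  then obtain w where w: "w \<in> S" "iter k u \<bullet> w \<noteq> 0"
    and z: "\<And>i. i < k \<Longrightarrow> k \<le> i + l \<Longrightarrow> iter i u \<bullet> w = 0"
    by blast
  have wc: "w \<in> carrier_vec n"
    using w S(3) by blast
  have dead: "iter j u = 0\<^sub>v n" if "Suc k \<le> j" for j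
    using iter_zero_mono[OF top that] .
  have iterS: "iter j w \<in> S" for j
    using w S(2) by (induction j) auto
  show ?case
  proof (cases "Suc l \<le> k")
    case False
    then show ?thesis
      using w z by (intro bexI[of _ w]) auto
  next
    case True
    \<comment> \<open>Solves the linear equation that makes the product at level
      \<open>k - Suc l\<close> vanish; the divisor is the nonzero top product.\<close>
    define a where "a = - ((-1) ^ Suc l) * (iter (k - Suc l) u \<bullet> w) / (iter k u \<bullet> w)"
    define w' where "w' = w + a \<cdot>\<^sub>v iter (Suc l) w"
    have prod: "iter i u \<bullet> w' = iter i u \<bullet> w + a * ((-1) ^ Suc l * (iter (i + Suc l) u \<bullet> w))" for i
      unfolding w'_def using u wc iter_scalar_prod[OF u wc, of i "Suc l"]
      by (simp add: scalar_prod_add_distrib[of _ n] scalar_prod_smult_distrib[of _ n] del: funpow.simps power_Suc)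
    have high: "iter i u \<bullet> w' = iter i u \<bullet> w" if "k < i + Suc l" for i
      using dead[of "i + Suc l"] that wc by (simp add: prod del: funpow.simps)
    have "w' \<in> S"
      unfolding w'_def using w(1) iterS by (intro S(1))
    moreover have "iter k u \<bullet> w' \<noteq> 0"
      using high[of k] w(2) by simp
    moreover have "iter i u \<bullet> w' = 0" if "i < k" "k \<le> i + Suc l" for i
    proof (cases "k = i + Suc l")
      case False
      then show ?thesis
        using high z that by simp
    next
      case True
      then have "i = k - Suc l" by simp
      have "((-1) ^ Suc l) * ((-1) ^ Suc l) = (1 :: complex)"
        by (simp flip: power_mult_distrib)
      then show ?thesis
        unfolding prod True[symmetric] a_def \<open>i = k - Suc l\<close>[symmetric] using w(2)
        by (simp add: field_simps del: power_Suc)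
    qed
    ultimately show ?thesis
      by blast
  qed
qed

section \<open>Orthogonal complements and exhaustion of the space\<close>

text \<open>A unit vector detects a nonzero coordinate of \<open>u\<close>; subtracting its
  projection to the column space of \<open>Q\<close> does not change the product with
  \<open>u\<close>.\<close>

lemma frame_orthogonal_nondegenerate:
  assumes F: "frame X n m Q N D"
    and u: "u \<in> carrier_vec n" "transpose_mat Q *\<^sub>v u = 0\<^sub>v m" "u \<noteq> 0\<^sub>v n"
  obtains w where "w \<in> carrier_vec n" "transpose_mat Q *\<^sub>v w = 0\<^sub>v m" "u \<bullet> w \<noteq> 0"
proof -
  have Q: "Q \<in> carrier_mat n m" and nz: "det (transpose_mat Q * Q) \<noteq> 0"
    using F by (auto simp: frame_def)
  have QQ: "transpose_mat Q * Q \<in> carrier_mat m m"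
    using Q by simp
  obtain H where H: "H \<in> carrier_mat m m" "(transpose_mat Q * Q) * H = 1\<^sub>m m"
    using det_non_zero_imp_unit[OF QQ nz, of "()"] by (auto simp: Units_def ring_mat_def)
  obtain i where i: "i < n" "u $ i \<noteq> 0"
    using u by (metis eq_vecI carrier_vecD index_zero_vec)
  define z :: "complex vec" where "z = unit_vec n i"
  \<comment> \<open>Since \<open>H\<close> inverts the Gram matrix, \<open>Q *\<^sub>v y\<close> is
    the orthogonal projection of \<open>z\<close>.\<close>
  define y where "y = H *\<^sub>v (transpose_mat Q *\<^sub>v z)"
  have z: "z \<in> carrier_vec n" and y: "y \<in> carrier_vec m"
    using Q H by (auto simp: z_def y_def)
  have "transpose_mat Q *\<^sub>v (Q *\<^sub>v y) = (transpose_mat Q * Q) *\<^sub>v y"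
    using Q y by (intro assoc_mult_mat_vec[symmetric]) auto
  also have "\<dots> = ((transpose_mat Q * Q) * H) *\<^sub>v (transpose_mat Q *\<^sub>v z)"
    unfolding y_def using QQ H Q z by (intro assoc_mult_mat_vec[symmetric]) auto
  also have "\<dots> = transpose_mat Q *\<^sub>v z"
    using H Q z by simp
  finally have "transpose_mat Q *\<^sub>v (z - Q *\<^sub>v y) = 0\<^sub>v m"
    using Q y z by (subst mult_minus_distrib_mat_vec[of _ m n]) auto
  moreover have "u \<bullet> (Q *\<^sub>v y) = 0"
    using transpose_vec_mult_scalar[OF Q y u(1)] u(2) y by simp
  then have "u \<bullet> (z - Q *\<^sub>v y) = u $ i"
    using u(1) z Q y i by (simp add: scalar_prod_minus_distrib[of _ n] z_def)
  ultimately show ?thesis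
    using that[of "z - Q *\<^sub>v y"] z Q y i by auto
qed

lemma frame_extend:
  assumes F: "frame X n m Q N D" and "m < n"
  shows "\<exists>m' Q' N' D'. m < m' \<and> frame X n m' Q' N' D'"
proof -
  define U where "U = {u \<in> carrier_vec n. transpose_mat Q *\<^sub>v u = 0\<^sub>v m}"
  have Q: "Q \<in> carrier_mat n m" and N: "N \<in> carrier_mat m m" and XQ: "X * Q = Q * N"
    using F by (auto simp: frame_def)
  have Qt: "transpose_mat Q \<in> carrier_mat m n"
    using Q by simp
  have Uc: "U \<subseteq> carrier_vec n"
    by (auto simp: U_def)
  have nondeg: "\<exists>w\<in>U. u \<bullet> w \<noteq> 0" if "u \<in> U" "u \<noteq> 0\<^sub>v n" for u
    using frame_orthogonal_nondegenerate[OF F, of u] that unfolding U_def by blast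
  have U_add: "x + a \<cdot>\<^sub>v y \<in> U" if "x \<in> U" "y \<in> U" for a x y
    using that Qt by (auto simp: U_def mult_add_distrib_mat_vec[of _ m n] mult_mat_vec[of _ m n])
  have U_X: "X *\<^sub>v u \<in> U" if "u \<in> U" for u
  proof -
    have u: "u \<in> carrier_vec n" "transpose_mat Q *\<^sub>v u = 0\<^sub>v m"
      using that by (auto simp: U_def)
    \<comment> \<open>Skewness turns invariance of the column space of \<open>Q\<close> into
      invariance of its complement \<open>U\<close>.\<close>
    have "transpose_mat Q * X = - (transpose_mat Q * transpose_mat X)"
      unfolding skew using Qt X by simp
    also have "\<dots> = - (transpose_mat N * transpose_mat Q)"
      using transpose_mult[OF X Q] transpose_mult[OF Q N] XQ by simp
    finally have "(transpose_mat Q * X) *\<^sub>v u = - (transpose_mat N *\<^sub>v (transpose_mat Q *\<^sub>v u))"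
      using N Qt u(1) by simp
    moreover have "transpose_mat N *\<^sub>v 0\<^sub>v m = 0\<^sub>v m"
      using N by auto
    ultimately show ?thesis
      using Qt X u by (simp add: U_def)
  qed
  have U_iter: "iter j u \<in> U" if "u \<in> U" for j u
    using that U_X by (induction j) auto
  have chain: "\<exists>m' Q' N' D'. m < m' \<and> frame X n m' Q' N' D'"
    if G: "frame X n d (mat_of_cols n (map c [0..<d])) M E" and "d > 0"
      and c: "\<And>j. c j \<in> U" for c d M E
  proof -
    have "col (transpose_mat Q * mat_of_cols n (map c [0..<d])) j = 0\<^sub>v m" if "j < d" for j
      using that c[of j] Qt by (subst col_mult2[of _ m n _ d]) (auto simp: U_def mat_of_cols_carrier)
    then have "transpose_mat Q * mat_of_cols n (map c [0..<d]) = 0\<^sub>m m d"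
      using Qt by (intro mat_col_eqI) auto
    from frame_append[OF X F G this] show ?thesis
      using \<open>d > 0\<close> by (metis less_add_same_cancel1)
  qed
  \<comment> \<open>\<open>P\<close> fails at 0, as \<open>m < n\<close> makes \<open>U\<close>
    nonzero, and holds eventually by nilpotency; where it switches, \<open>k\<close> is the top
    nonzero power on \<open>U\<close>.\<close>
  define P where "P k \<longleftrightarrow> (\<forall>u\<in>U. iter k u = 0\<^sub>v n)" for k
  have "\<exists>k. P k"
    using iter_nilpotent Uc by (auto simp: P_def)
  moreover obtain z where "z \<in> carrier_vec n" "z \<noteq> 0\<^sub>v n" "transpose_mat Q *\<^sub>v z = 0\<^sub>v m"
    by (rule wide_mat_kernel[OF Qt \<open>m < n\<close>])
  then have "\<not> P 0"
    by (auto simp: P_def U_def)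
  ultimately obtain k where k: "\<not> P k" "P (Suc k)"
    using exists_least_lemma[of P] by blast
  then obtain u where u: "u \<in> U" "iter k u \<noteq> 0\<^sub>v n"
    by (auto simp: P_def)
  then obtain v where v: "v \<in> U" "iter k u \<bullet> v \<noteq> 0"
    using nondeg[OF U_iter[OF u(1)] u(2)] by blast
  have top: "iter (Suc k) x = 0\<^sub>v n" if "x \<in> U" for x
    using k that by (auto simp: P_def)
  show ?thesis
  proof (cases "even k")
    case True
    have "\<exists>x\<in>U. iter k x \<bullet> x \<noteq> 0"
    proof (rule ccontr)
      assume none: "\<not> ?thesis"
      have uv: "u \<in> carrier_vec n" "v \<in> carrier_vec n" "u + v \<in> U"
        using u v Uc U_add[of u v 1] by auto
      \<comment> \<open>Polarization: for even \<open>k\<close> the form is symmetric, so a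
        vanishing diagonal would force its value at \<open>u\<close>, \<open>v\<close> to be
        zero.\<close>
      have "iter k (u + v) \<bullet> (u + v)
          = iter k u \<bullet> u + iter k u \<bullet> v + (iter k v \<bullet> u + iter k v \<bullet> v)"
        using uv by (simp add: iter_add add_scalar_prod_distrib[of _ n] scalar_prod_add_distrib[of _ n])
      then have "2 * (iter k u \<bullet> v) = 0"
        using none u v uv True by (simp add: iter_scalar_prod_swap[of u v])
      with v show False
        by simp
    qed
    then obtain x where x: "x \<in> U" "iter k x \<bullet> x \<noteq> 0"
      by blast
    then obtain M E where
      "frame X n (Suc k) (mat_of_cols n (map (\<lambda>j. iter j x) [0..<Suc k])) M E"
      using frame_one_chain[of x k] True top[of x] Uc by blast
    then show ?thesis
      by (rule chain) (use U_iter x in auto)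
  next
    case False
    obtain w where w: "w \<in> U" "iter k u \<bullet> w \<noteq> 0" "\<And>i. i < k \<Longrightarrow> iter i u \<bullet> w = 0"
      using normalize_chain_partner[OF _ top[OF u(1)] U_add U_X Uc v, of k] u(1) Uc by auto
    then obtain M E where
      "frame X n (2 * Suc k)
        (mat_of_cols n (map (\<lambda>j. iter (j div 2) (if even j then u else w)) [0..<2 * Suc k])) M E"
      using frame_two_chains[of u w k] False top[OF u(1)] top[OF w(1)] u(1) Uc by blast
    then show ?thesis
      by (rule chain) (use U_iter u w in auto)
  qed
qed

text \<open>A frame of greatest size cannot be extended, so it fills the space. The search starts
  from the empty frame, whose determinants of size 0 are 1.\<close>

lemma strongly_real: "strongly_Ad_real (SO n) X"
proof -
  define P where "P m \<longleftrightarrow> (\<exists>Q N D. frame X n m Q N D)" for m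
  have "frame X n 0 (0\<^sub>m n 0) (0\<^sub>m 0 0) (0\<^sub>m 0 0)"
    using X by (auto simp: frame_def intro!: eq_matI)
  then have "P 0"
    by (auto simp: P_def)
  have "\<forall>y. P y \<longrightarrow> y \<le> n"
    using frame_size by (auto simp: P_def)
  from Nat.ex_has_greatest_nat[of P, OF \<open>P 0\<close> this]
  obtain m where m: "P m" "\<And>y. P y \<Longrightarrow> y \<le> m"
    by blast
  then obtain Q N D where F: "frame X n m Q N D"
    by (auto simp: P_def)
  have "m = n"
    using frame_size[OF F] frame_extend[OF F] m(2) by (metis P_def leD le_neq_implies_less)
  with F frame_total_strongly_real[OF X] show ?thesis
    by blast
qed

end

theorem theorem4p8:
  fixes n :: nat and X :: "complex mat"
  assumes "n \<ge> 2"
    and "X \<in> so n"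
    and "nilpotent_mat X"
  shows "strongly_Ad_real (SO n) X"
proof -
  have X: "X \<in> carrier_mat n n" and sum: "transpose_mat X + X = 0\<^sub>m n n"
    using assms(2) by (auto simp: so_def sl_def)
  have "transpose_mat X = - X"
  proof (rule eq_matI)
    fix i j assume "i < dim_row (- X)" "j < dim_col (- X)"
    then have "(transpose_mat X + X) $$ (i, j) = 0"
      using X sum by simp
    then show "transpose_mat X $$ (i, j) = (- X) $$ (i, j)"
      using X \<open>i < dim_row (- X)\<close> \<open>j < dim_col (- X)\<close> by (simp add: add_eq_0_iff2)
  qed (use X in auto)
  then interpret nilpotent_skew n X
    using X assms(3) by unfold_locales
  show ?thesis
    by (rule strongly_real)
qed

end
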